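(* Suppose that $c<0$ and $0<\theta<1$. Then, as $z$ tends to $-1^+$ in $\mathbb{R}$, $$\mathrm{E}(z;c,\theta)\sim u_0+u_1(1+z)+u_2(1+z)^2+\cdots$$ (as an asymptotic series), where the coefficients are given by $$u_k=\frac{1}{k!}\lim_{z\to-1^+}\frac{\mathrm{d}^k}{\mathrm{d}z^k}\mathrm{E}(z;c,\theta)=(-1)^k\sum_{n\ge1}\binom nk\exp(cn^\theta),\qquad k\ge0.$$
   Context: $\mathrm{E}(z;c,\theta)=\sum_{n=1}^\infty\mathrm{e}^{cn^\theta}(-z)^n$ for $|z|<1$. The asymptotic series notation means that for every $K\ge0$, $\mathrm{E}(z;c,\theta)=\sum_{k=0}^{K}u_k(1+z)^k+\mathrm{o}((1+z)^{K})$ as $z\to-1^+$. *)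

theory Defs
  imports "HOL-Analysis.Analysis" "HOL-Library.Landau_Symbols"
begin

text \<open>
  The series starts at exponent 1, hence the shift to \<open>Suc n\<close>; it is meaningful for \<open>norm z < 1\<close>.
  The type of \<open>z\<close> covers both real and complex arguments.
\<close>

definition E :: "'a::{real_normed_field,banach} \<Rightarrow> real \<Rightarrow> real \<Rightarrow> 'a" where
  "E z c \<theta> = (\<Sum>n. of_real (exp (c * real (Suc n) powr \<theta>)) * (- z) ^ Suc n)"

end

theory Submission
  imports Defs
begin

text \<open>
  The coefficients \<open>exp (c * n powr \<theta>)\<close> decay faster than every power of \<open>n\<close>. So, although the
  circle of convergence of the power series has radius 1 and the point \<open>-1\<close> lies on it, the series
  and all its formally differentiated series converge absolutely and uniformly up to the boundary.
  On the closed interval \<open>{-1..1}\<close> the sum is therefore a smooth function with one-sided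
  derivatives at the end points, and these derivatives are given by termwise differentiation
  (\<open>taylor_coeff_series_derivative\<close>).
  The asymptotic series at \<open>-1\<close> is the Taylor series of this function at the end point:
  Taylor's theorem with a bounded next derivative gives a remainder of order \<open>(1 + z) ^ Suc K\<close>
  (\<open>taylor_coeff_series_asymptotic\<close>), continuity at the end point gives the limits of the
  derivatives, and putting \<open>z = -1\<close> in the differentiated series gives the binomial sums.

  All of this holds for any coefficients of rapid decay. The exponential enters only in
  \<open>rapidly_decreasing_stretched_exp\<close>, through the inequality \<open>y ^ p \<le> fact p * exp y\<close> with
  \<open>y = - c * n powr \<theta>\<close> and \<open>p\<close> large compared with \<open>1 / \<theta>\<close>.
\<close>

section \<open>Power series that are smooth up to the boundary\<close>

text \<open>
  This is the series \<open>\<Sum>n. a n * (- z) ^ Suc n\<close> differentiated \<open>k\<close> times term by term and divided by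
  \<open>fact k\<close>. Where \<open>k > Suc n\<close> the subtraction in the exponent truncates, but there the binomial
  coefficient makes the term vanish.
\<close>

definition taylor_coeff_series :: "(nat \<Rightarrow> real) \<Rightarrow> nat \<Rightarrow> real \<Rightarrow> real" where
  "taylor_coeff_series a k z =
     (\<Sum>n. a n * ((-1) ^ k * real (Suc n choose k) * (- z) ^ (Suc n - k)))"

text \<open>
  The weights are the Taylor coefficients of the monomials \<open>(- z) ^ Suc n\<close> at \<open>z = -1\<close>, up to sign.
  Since \<open>Suc n choose k\<close> is a polynomial in \<open>n\<close> of degree \<open>k\<close>, this is decay faster than every power of \<open>n\<close>.
\<close>

definition rapidly_decreasing :: "(nat \<Rightarrow> real) \<Rightarrow> bool" where
  "rapidly_decreasing a \<longleftrightarrow> (\<forall>k. summable (\<lambda>n. real (Suc n choose k) * \<bar>a n\<bar>))"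

text \<open>
  The bound does not depend on \<open>z\<close>, which makes it the majorant for uniform convergence on the
  closed interval.
\<close>

lemma taylor_coeff_term_bound:
  fixes z :: real
  assumes "z \<in> {-1..1}"
  shows "norm (a n * ((-1) ^ k * real (Suc n choose k) * (- z) ^ (Suc n - k)))
           \<le> real (Suc n choose k) * \<bar>a n\<bar>"
proof -
  have "\<bar>z\<bar> ^ (Suc n - k) \<le> 1"
    using assms by (intro power_le_one) auto
  then have "\<bar>a n\<bar> * real (Suc n choose k) * \<bar>z\<bar> ^ (Suc n - k) \<le> \<bar>a n\<bar> * real (Suc n choose k) * 1"
    by (intro mult_left_mono) auto
  then show ?thesis
    by (simp add: abs_mult power_abs mult_ac)
qed

lemma taylor_coeff_summable:
  assumes "rapidly_decreasing a" and "z \<in> {-1..1}"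
  shows "summable (\<lambda>n. a n * ((-1) ^ k * real (Suc n choose k) * (- z) ^ (Suc n - k)))"
  using assms(1) taylor_coeff_term_bound[OF assms(2)]
  unfolding rapidly_decreasing_def by (blast intro: summable_comparison_test')

lemma taylor_coeff_series_bounded:
  assumes "rapidly_decreasing a" and "z \<in> {-1..1}"
  shows "\<bar>taylor_coeff_series a k z\<bar> \<le> (\<Sum>n. real (Suc n choose k) * \<bar>a n\<bar>)"
  unfolding taylor_coeff_series_def real_norm_def[symmetric]
  using assms(1) taylor_coeff_term_bound[OF assms(2)]
  by (intro norm_suminf_le) (simp_all only: rapidly_decreasing_def real_norm_def)

lemma power_term_derivative:
  fixes z :: real
  shows "((\<lambda>z. (-1) ^ k * real (m choose k) * (- z) ^ (m - k)) has_field_derivative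
           (real (Suc k) * ((-1) ^ Suc k * real (m choose Suc k) * (- z) ^ (m - Suc k))))
           (at z within S)"
proof -
  have absorb: "real (m - k) * real (m choose k) = real (Suc k) * real (m choose Suc k)"
    using binomial_absorb_comp[of m k] binomial_absorption[of k m]
    by (metis of_nat_mult)
  show ?thesis
    by (rule derivative_eq_intros refl)+ (use absorb in simp)
qed

text \<open>
  Termwise differentiation is justified by the uniform convergence of the differentiated series
  (Weierstrass M-test). The interval is closed, so at \<open>z = -1\<close> this is a one-sided derivative at a
  point that may lie on the circle of convergence, where the theorems about the open disc do not
  apply.
\<close>

lemma taylor_coeff_series_derivative:
  assumes a: "rapidly_decreasing a" and z: "z \<in> {-1..1}"
  shows "(taylor_coeff_series a k has_field_derivative
           real (Suc k) * taylor_coeff_series a (Suc k) z) (at z within {-1..1})"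
proof -
  define t where "t k n z = a n * ((-1) ^ k * real (Suc n choose k) * (- z) ^ (Suc n - k))"
    for k n and z :: real
  have series: "taylor_coeff_series a k = (\<lambda>z. \<Sum>n. t k n z)" for k
    by (simp add: taylor_coeff_series_def t_def fun_eq_iff)
  have summ: "summable (\<lambda>n. t k n z)" if "z \<in> {-1..1}" for k z
    using taylor_coeff_summable[OF a that] by (simp add: t_def)
  have unif: "uniform_limit {-1..1} (\<lambda>N z. \<Sum>n<N. real (Suc k) * t (Suc k) n z)
          (\<lambda>z. \<Sum>n. real (Suc k) * t (Suc k) n z) sequentially"
  proof (rule Weierstrass_m_test)
    show "norm (real (Suc k) * t (Suc k) n z)
            \<le> real (Suc k) * (real (Suc n choose Suc k) * \<bar>a n\<bar>)" if "z \<in> {-1..1}" for n z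
      using mult_left_mono[OF taylor_coeff_term_bound[OF that, of a n "Suc k"], of "real (Suc k)"]
      by (simp only: t_def norm_mult norm_of_nat of_nat_0_le_iff)
    show "summable (\<lambda>n. real (Suc k) * (real (Suc n choose Suc k) * \<bar>a n\<bar>))"
      using a unfolding rapidly_decreasing_def by (intro summable_mult) blast
  qed
  have term_deriv: "(t k n has_field_derivative real (Suc k) * t (Suc k) n z) (at z within {-1..1})"
    for n z
    unfolding t_def
    using DERIV_cmult[OF power_term_derivative, of "a n"] by (simp only: mult.left_commute)
  obtain g where g: "\<forall>z\<in>{-1..1}. (\<lambda>n. t k n z) sums g z \<and>
      (g has_field_derivative (\<Sum>n. real (Suc k) * t (Suc k) n z)) (at z within {-1..1})"
    using has_field_derivative_series[OF convex_real_interval(5) term_deriv unif z summ[OF z]]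
    by blast
  have "(g has_field_derivative real (Suc k) * taylor_coeff_series a (Suc k) z) (at z within {-1..1})"
    using bspec[OF g z, THEN conjunct2] by (simp only: series suminf_mult[OF summ[OF z]])
  then show ?thesis
    by (rule has_field_derivative_transform_within[OF _ zero_less_one z])
       (use g in \<open>auto simp: series sums_iff\<close>)
qed

text \<open>
  The operator \<^const>\<open>deriv\<close> is two-sided, hence the restriction to interior points.
\<close>

lemma higher_deriv_taylor_coeff_series:
  assumes a: "rapidly_decreasing a" and "z \<in> {-1<..<1}"
  shows "(deriv ^^ k) (taylor_coeff_series a 0) z = fact k * taylor_coeff_series a k z"
  using assms(2)
proof (induction k arbitrary: z)
  case (Suc k)
  have "eventually (\<lambda>w. (deriv ^^ k) (taylor_coeff_series a 0) w = fact k * taylor_coeff_series a k w) (nhds z)"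
    using eventually_nhds_in_open[of "{-1<..<1}" z] Suc
    by (auto elim: eventually_mono)
  then have "(deriv ^^ Suc k) (taylor_coeff_series a 0) z
               = deriv (\<lambda>w. fact k * taylor_coeff_series a k w) z"
    by (simp add: deriv_cong_ev)
  also have "\<dots> = fact k * (real (Suc k) * taylor_coeff_series a (Suc k) z)"
  proof (intro DERIV_imp_deriv DERIV_cmult)
    show "(taylor_coeff_series a k has_field_derivative real (Suc k) * taylor_coeff_series a (Suc k) z) (at z)"
      using taylor_coeff_series_derivative[OF a, of z k] Suc.prems at_within_Icc_at[of "-1" z 1]
      by simp
  qed
  finally show ?case by (simp add: mult_ac)
qed simp

lemma taylor_coeff_series_tendsto:
  assumes a: "rapidly_decreasing a"
  shows "(taylor_coeff_series a k \<longlongrightarrow> taylor_coeff_series a k (-1)) (at_right (-1))"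
proof -
  have "continuous (at (-1) within {-1..1}) (taylor_coeff_series a k)"
    using taylor_coeff_series_derivative[OF a, of "-1" k]
    by (intro DERIV_continuous) auto
  then show ?thesis
    by (simp add: continuous_within at_within_Icc_at_right)
qed

text \<open>
  By Taylor's theorem at the end point \<open>-1\<close>, since the derivative of order \<open>Suc K\<close> is
  bounded on the whole closed interval.
\<close>

lemma taylor_coeff_series_asymptotic:
  assumes a: "rapidly_decreasing a"
  shows "(\<lambda>z. taylor_coeff_series a 0 z - (\<Sum>k=0..K. taylor_coeff_series a k (-1) * (1 + z) ^ k))
           \<in> o[at_right (-1)](\<lambda>z. (1 + z) ^ K)"
proof -
  define B where "B = (\<Sum>n. real (Suc n choose Suc K) * \<bar>a n\<bar>)"
  have remainder: "norm (taylor_coeff_series a 0 z - (\<Sum>k=0..K. taylor_coeff_series a k (-1) * (1 + z) ^ k))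
          \<le> (fact (Suc K) * B / fact K) * norm ((1 + z) ^ Suc K)"
    if z: "z \<in> {-1..1}" for z
  proof -
    have "norm (fact 0 * taylor_coeff_series a 0 z -
            (\<Sum>k\<le>K. fact k * taylor_coeff_series a k (-1) * (z - (-1)) ^ k / fact k))
          \<le> (fact (Suc K) * B) * norm (z - (-1)) ^ Suc K / fact K"
    proof (rule field_Taylor[where f = "\<lambda>k z. fact k * taylor_coeff_series a k z"])
      show "((\<lambda>z. fact i * taylor_coeff_series a i z) has_field_derivative
              fact (Suc i) * taylor_coeff_series a (Suc i) x) (at x within {-1..1})"
        if "x \<in> {-1..1}" for i x
        using DERIV_cmult[OF taylor_coeff_series_derivative[OF a that, of i], of "fact i"]
        by (simp add: mult_ac)
      show "norm (fact (Suc K) * taylor_coeff_series a (Suc K) x) \<le> fact (Suc K) * B"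
        if "x \<in> {-1..1}" for x
        unfolding norm_mult norm_fact B_def
        using taylor_coeff_series_bounded[OF a that, of "Suc K"]
        by (intro mult_left_mono) auto
    qed (use z in auto)
    then show ?thesis
      by (simp add: atMost_atLeast0 abs_mult power_abs add.commute mult_ac)
  qed
  have "eventually (\<lambda>z::real. z \<in> {-1<..<1}) (at_right (-1))"
    by (intro eventually_at_right_real) simp
  then have "(\<lambda>z. taylor_coeff_series a 0 z - (\<Sum>k=0..K. taylor_coeff_series a k (-1) * (1 + z) ^ k))
           \<in> O[at_right (-1)](\<lambda>z. (1 + z) ^ Suc K)"
    by (intro bigoI[where c = "fact (Suc K) * B / fact K"], elim eventually_mono, intro remainder)
       simp
  also have "(\<lambda>z. (1 + z) ^ Suc K) \<in> o[at_right (-1)](\<lambda>z::real. (1 + z) ^ K)"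
  proof -
    have "((\<lambda>z::real. 1 + z) \<longlongrightarrow> 1 + (-1)) (at_right (-1))"
      by (intro tendsto_intros)
    then have "(\<lambda>z::real. 1 + z) \<in> o[at_right (-1)](\<lambda>_. 1)"
      by (intro smalloI_tendsto) auto
    then show ?thesis
      using landau_o.small_big_mult[of "\<lambda>z::real. 1 + z" _ "\<lambda>_. 1" "\<lambda>z. (1 + z) ^ K"] by simp
  qed
  finally show ?thesis .
qed

section \<open>Decay of the stretched exponential\<close>

text \<open>
  The left-hand side, divided by \<open>fact p\<close>, is a single term of the exponential series.
\<close>

lemma power_le_fact_exp:
  fixes y :: real
  assumes "0 \<le> y"
  shows "y ^ p \<le> fact p * exp y"
proof -
  have "(\<Sum>n\<in>{p}. y ^ n /\<^sub>R fact n) \<le> (\<Sum>n. y ^ n /\<^sub>R fact n)"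
    using assms by (intro sum_le_suminf summable_exp_generic) auto
  then show ?thesis
    by (simp add: exp_def field_simps)
qed

lemma stretched_exp_decay:
  assumes c: "c < 0" and \<theta>: "0 < \<theta>"
  obtains C where "\<And>n. real (Suc n) ^ k * exp (c * real (Suc n) powr \<theta>) \<le> C / real (Suc n) ^ 2"
proof -
  \<comment> \<open>With this \<open>p\<close>, the power \<open>(x powr \<theta>) ^ p\<close> dominates \<open>x ^ (k + 2)\<close>: the factor \<open>x ^ k\<close> is
      absorbed and \<open>x ^ 2\<close> is left over for summability.\<close>
  obtain p :: nat where p: "real (k + 2) / \<theta> \<le> real p"
    using real_arch_simple by blast
  have "real (Suc n) ^ k * exp (c * real (Suc n) powr \<theta>) \<le> fact p / (- c) ^ p / real (Suc n) ^ 2" for n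
  proof -
    define x where "x = real (Suc n)"
    have x: "x \<ge> 1" by (simp add: x_def)
    have "x ^ (k + 2) = x powr real (k + 2)"
      using x powr_realpow[of x "k + 2"] by linarith
    also have "\<dots> \<le> x powr (\<theta> * real p)"
      using p \<theta> x by (intro powr_mono) (auto simp: field_simps)
    also have "\<dots> = (x powr \<theta>) ^ p"
      using x by (simp add: powr_powr[symmetric] powr_realpow)
    finally have "(- c) ^ p * x ^ (k + 2) \<le> (- c * x powr \<theta>) ^ p"
      using c unfolding power_mult_distrib by (intro mult_left_mono) auto
    also have "\<dots> \<le> fact p * exp (- c * x powr \<theta>)"
      using c by (intro power_le_fact_exp mult_nonneg_nonneg) auto
    finally have "(- c) ^ p * x ^ (k + 2) * exp (c * x powr \<theta>) \<le> fact p"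
      by (simp add: exp_minus field_simps)
    moreover have "(- c) ^ p > 0"
      using c by simp
    ultimately show ?thesis
      using x unfolding x_def[symmetric] by (simp add: field_simps power_add power2_eq_square)
  qed
  then show thesis using that by blast
qed

lemma rapidly_decreasing_stretched_exp:
  assumes "c < 0" and "0 < \<theta>"
  shows "rapidly_decreasing (\<lambda>n. exp (c * real (Suc n) powr \<theta>))"
  unfolding rapidly_decreasing_def
proof
  fix k
  obtain C where C: "\<And>n. real (Suc n) ^ k * exp (c * real (Suc n) powr \<theta>) \<le> C / real (Suc n) ^ 2"
    using stretched_exp_decay[OF assms] by blast
  have "real (Suc n choose k) \<le> real (Suc n) ^ k" for n
    by (metis binomial_le_pow binomial_eq_0 le_less_linear of_nat_0_le_iff of_nat_le_iff of_nat_power of_nat_0 zero_le_power)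
  then have "norm (real (Suc n choose k) * \<bar>exp (c * real (Suc n) powr \<theta>)\<bar>) \<le> C / real (Suc n) ^ 2" for n
    by (intro order_trans[OF _ C]) (simp add: mult_right_mono)
  moreover have "summable (\<lambda>n. C / real (Suc n) ^ 2)"
    using summable_mult[OF summable_Suc_iff[THEN iffD2, OF inverse_power_summable[of 2]], of C]
    by (simp add: field_simps)
  ultimately show "summable (\<lambda>n. real (Suc n choose k) * \<bar>exp (c * real (Suc n) powr \<theta>)\<bar>)"
    by (rule summable_comparison_test'[rotated])
qed

section \<open>The asymptotic expansion at -1\<close>

theorem proposition5:
  fixes c \<theta> :: real
  assumes "c < 0" and "0 < \<theta>" and "\<theta> < 1"
  shows "\<exists>u :: nat \<Rightarrow> real.
    (\<forall>K. (\<lambda>z::real. E z c \<theta> - (\<Sum>k=0..K. u k * (1 + z) ^ k))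
            \<in> o[at_right (-1)](\<lambda>z. (1 + z) ^ K)) \<and>
    (\<forall>k. ((\<lambda>z::real. 1 / fact k * (deriv ^^ k) (\<lambda>w. E w c \<theta>) z) \<longlongrightarrow> u k) (at_right (-1)) \<and>
         summable (\<lambda>n. real (Suc n choose k) * exp (c * real (Suc n) powr \<theta>)) \<and>
         u k = (-1) ^ k * (\<Sum>n. real (Suc n choose k) * exp (c * real (Suc n) powr \<theta>)))"
proof -
  define a where "a n = exp (c * real (Suc n) powr \<theta>)" for n
  have a: "rapidly_decreasing a"
    using rapidly_decreasing_stretched_exp[OF assms(1,2)] unfolding a_def .
  have E_eq: "E z c \<theta> = taylor_coeff_series a 0 z" for z :: real
    by (simp add: E_def taylor_coeff_series_def a_def)
  have summ: "summable (\<lambda>n. real (Suc n choose k) * a n)" for k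
    using a by (simp add: rapidly_decreasing_def a_def)
  have value_at_minus_one:
    "taylor_coeff_series a k (-1) = (-1) ^ k * (\<Sum>n. real (Suc n choose k) * a n)" for k
    using suminf_mult[OF summ, of "(-1) ^ k" k]
    by (simp add: taylor_coeff_series_def mult_ac)
  have deriv_limit: "((\<lambda>z. 1 / fact k * (deriv ^^ k) (taylor_coeff_series a 0) z)
          \<longlongrightarrow> taylor_coeff_series a k (-1)) (at_right (-1))" for k
  proof (rule Lim_transform_eventually[OF taylor_coeff_series_tendsto[OF a]])
    have "eventually (\<lambda>z::real. z \<in> {-1<..<1}) (at_right (-1))"
      by (intro eventually_at_right_real) simp
    then show "\<forall>\<^sub>F z in at_right (-1). taylor_coeff_series a k z
                 = 1 / fact k * (deriv ^^ k) (taylor_coeff_series a 0) z"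
      by eventually_elim (simp add: higher_deriv_taylor_coeff_series[OF a])
  qed
  show ?thesis
    unfolding E_eq a_def[symmetric]
    by (intro exI[of _ "\<lambda>k. taylor_coeff_series a k (-1)"] conjI allI)
       (fact taylor_coeff_series_asymptotic[OF a] deriv_limit summ value_at_minus_one)+
qed

end
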